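(* Let $n\ge1$, let $P$ be a finite partially ordered set, let $\mathcal J$ be a poset ideal in $\mathrm{Hom}(P,[n])$, let $R$ be a partially ordered set, and let $\phi:[n]\times P\to R$ be an isotone map such that the fibers $\phi^{-1}(r)$, $r\in R$, are bistrict chains in $[n]\times P^{op}$. Then the ideals $L^{\phi}(n,P;\mathcal J)$ and $L^{\phi^\tau}(P,n;\mathcal J)$ in $\Bbbk[x_R]$ are Alexander dual.
   Context: $\Bbbk$ is a field and $[n]=\{1<2<\cdots<n\}$ is the chain on $n$ elements. For a set $A$, $\Bbbk[x_A]$ is the polynomial ring in variables $x_a$, $a\in A$. A map of posets is isotone if it is order preserving; $\mathrm{Hom}(P,[n])$ is the set of isotone maps $P\to[n]$, partially ordered by $\psi\le\psi'$ iff $\psi(p)\le\psi'(p)$ for all $p$. A poset ideal of a poset is a subset $J$ such that $q\in J$ and $p\le q$ imply $p\in J$. Products of posets carry the componentwise order, and $P^{op}$ is the opposite poset of $P$. The Alexander dual of a squarefree monomial ideal $I\subseteq\Bbbk[x_A]$ is the monomial ideal of $\Bbbk[x_A]$ whose monomials are those having a nontrivial common divisor with every monomial in $I$. $L(P,n;\mathcal J)\subseteq\Bbbk[x_{P\times[n]}]$ is the ideal generated by all monomials $\prod_{p\in P}x_{p,\psi(p)}$ with $\psi\in\mathcal J$. $L(n,P;\mathcal J)\subseteq\Bbbk[x_{[n]\times P}]$ is its Alexander dual, where $\Bbbk[x_{P\times[n]}]$ and $\Bbbk[x_{[n]\times P}]$ are identified by $x_{p,i}\leftrightarrow x_{i,p}$.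 $\phi^\tau:P\times[n]\to R$ is the map $\phi^\tau(p,i)=\phi(i,p)$. $L^\phi(n,P;\mathcal J)$ is the ideal of $\Bbbk[x_R]$ generated by the image of $L(n,P;\mathcal J)$ under the $\Bbbk$-algebra map $x_{i,p}\mapsto x_{\phi(i,p)}$, and $L^{\phi^\tau}(P,n;\mathcal J)$ is the ideal of $\Bbbk[x_R]$ generated by the image of $L(P,n;\mathcal J)$ under $x_{p,i}\mapsto x_{\phi(i,p)}$. A chain in a product of posets $Q\times Q'$ is bistrict if for any two of its elements, $(a,b)<(a',b')$ implies both $a<a'$ and $b<b'$ (the latter in $Q'$). *)

theory Defs
  imports
    "HOL-Library.Poly_Mapping"
    "HOL-Library.FuncSet"
    "HOL-Library.Product_Order"
    "HOL-Library.Dual_Ordered_Lattice"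
    "HOL-Algebra.Ideal"
begin

text \<open>
  A monomial is an exponent vector of finite support, and a polynomial is a finitely supported
  map from exponent vectors to coefficients; the product of the type is convolution.
  A poset is a set \<open>P\<close> of elements of a type of class \<^class>\<open>order\<close>, with the induced order.
\<close>

type_synonym ('a, 'k) mpoly = "('a \<Rightarrow>\<^sub>0 nat) \<Rightarrow>\<^sub>0 'k"


subsection \<open>The polynomial ring in variables indexed by a set\<close>

definition Var :: "'a \<Rightarrow> ('a, 'k::field) mpoly" where
  "Var a = Poly_Mapping.single (Poly_Mapping.single a 1) 1"

definition Const :: "'k::field \<Rightarrow> ('a, 'k) mpoly" where
  "Const c = Poly_Mapping.single 0 c"

definition poly_ring :: "'a set \<Rightarrow> ('a, 'k::field) mpoly ring" where
  "poly_ring A =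
    \<lparr>carrier = {f. \<forall>m \<in> Poly_Mapping.keys f. Poly_Mapping.keys m \<subseteq> A},
     mult = (*), one = 1, zero = 0, add = (+)\<rparr>"

lemma cring_poly_ring: "cring (poly_ring A :: ('a, 'k::field) mpoly ring)"
proof (rule cringI)
  let ?R = "poly_ring A :: ('a, 'k) mpoly ring"
  have add: "f + g \<in> carrier ?R" if "f \<in> carrier ?R" "g \<in> carrier ?R" for f g
    using that Poly_Mapping.keys_add[of f g] by (fastforce simp: poly_ring_def)
  have mult: "f * g \<in> carrier ?R" if "f \<in> carrier ?R" "g \<in> carrier ?R" for f g
  proof -
    have "Poly_Mapping.keys m \<subseteq> A" if m: "m \<in> Poly_Mapping.keys (f * g)" for m
    proof -
      obtain u v where "u \<in> Poly_Mapping.keys f" "v \<in> Poly_Mapping.keys g" "m = u + v"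
        using m Poly_Mapping.keys_mult[of f g] by blast
      then show ?thesis
        using \<open>f \<in> carrier ?R\<close> \<open>g \<in> carrier ?R\<close> Poly_Mapping.keys_add[of u v]
        by (fastforce simp: poly_ring_def)
    qed
    then show ?thesis by (simp add: poly_ring_def)
  qed
  have uminus: "- f \<in> carrier ?R" if "f \<in> carrier ?R" for f
    using that by (simp add: poly_ring_def)
  show "abelian_group ?R"
  proof (rule abelian_groupI)
    fix f assume "f \<in> carrier ?R"
    then have "- f \<in> carrier ?R" "- f \<oplus>\<^bsub>?R\<^esub> f = \<zero>\<^bsub>?R\<^esub>"
      by (rule uminus) (simp add: poly_ring_def)
    then show "\<exists>g \<in> carrier ?R. g \<oplus>\<^bsub>?R\<^esub> f = \<zero>\<^bsub>?R\<^esub>" by blast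
  next
    fix f g assume "f \<in> carrier ?R" "g \<in> carrier ?R"
    then show "f \<oplus>\<^bsub>?R\<^esub> g \<in> carrier ?R"
      using add[of f g] by (simp add: poly_ring_def)
  qed (simp_all add: poly_ring_def algebra_simps)
  show "comm_monoid ?R"
  proof (rule comm_monoidI)
    fix f g assume "f \<in> carrier ?R" "g \<in> carrier ?R"
    then show "f \<otimes>\<^bsub>?R\<^esub> g \<in> carrier ?R"
      using mult[of f g] by (simp add: poly_ring_def)
  qed (simp_all add: poly_ring_def algebra_simps)
qed (simp add: poly_ring_def algebra_simps)

text \<open>
  The value of the \<open>k\<close>-algebra map \<open>x\<^sub>a \<mapsto> x\<^bsub>g a\<^esub>\<close> at \<open>f\<close>.
\<close>

definition var_map :: "('a \<Rightarrow> 'b) \<Rightarrow> ('a, 'k::field) mpoly \<Rightarrow> ('b, 'k) mpoly" where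
  "var_map g f =
    (\<Sum>m \<in> Poly_Mapping.keys f. Const (Poly_Mapping.lookup f m) *
      (\<Prod>a \<in> Poly_Mapping.keys m. Var (g a) ^ Poly_Mapping.lookup m a))"


subsection \<open>Monomial ideals and Alexander duality\<close>

definition monomials :: "'a set \<Rightarrow> ('a, 'k::field) mpoly set" where
  "monomials A = {Poly_Mapping.single m 1 | m. Poly_Mapping.keys m \<subseteq> A}"

definition squarefree_monomials :: "'a set \<Rightarrow> ('a, 'k::field) mpoly set" where
  "squarefree_monomials A = {\<Prod>a\<in>S. Var a | S. finite S \<and> S \<subseteq> A}"

definition squarefree_monomial_ideal :: "'a set \<Rightarrow> ('a, 'k::field) mpoly set \<Rightarrow> bool" where
  "squarefree_monomial_ideal A I \<longleftrightarrow>
    (\<exists>G \<subseteq> squarefree_monomials A. I = Idl\<^bsub>poly_ring A\<^esub> G)"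

text \<open>
  The generating set below is closed under multiplication by monomials, so its elements
  are exactly the monomials of the ideal it generates.
\<close>

definition alexander_dual :: "'a set \<Rightarrow> ('a, 'k::field) mpoly set \<Rightarrow> ('a, 'k) mpoly set" where
  "alexander_dual A I =
    Idl\<^bsub>poly_ring A\<^esub>
      {u \<in> monomials A. \<forall>v \<in> monomials A \<inter> I. \<exists>d \<in> monomials A. d \<noteq> 1 \<and> d dvd u \<and> d dvd v}"

definition are_alexander_dual ::
    "'a set \<Rightarrow> ('a, 'k::field) mpoly set \<Rightarrow> ('a, 'k) mpoly set \<Rightarrow> bool" where
  "are_alexander_dual A I I' \<longleftrightarrow>
    squarefree_monomial_ideal A I \<and> squarefree_monomial_ideal A I' \<and>
    I' = alexander_dual A I \<and> I = alexander_dual A I'"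


subsection \<open>Posets\<close>

text \<open>
  Isotone maps \<open>P \<rightarrow> [n]\<close> are represented by functions taking the fixed value
  \<^term>\<open>undefined\<close> outside \<open>P\<close>, so the pointwise order of the function type restricts to the
  pointwise order on \<open>P\<close>.
\<close>

definition Hom_chain :: "'p::order set \<Rightarrow> nat \<Rightarrow> ('p \<Rightarrow> nat) set" where
  "Hom_chain P n = {\<psi> \<in> P \<rightarrow>\<^sub>E {1..n}. mono_on P \<psi>}"

definition poset_ideal :: "'a::order set \<Rightarrow> 'a set \<Rightarrow> bool" where
  "poset_ideal Q J \<longleftrightarrow> J \<subseteq> Q \<and> (\<forall>q\<in>J. \<forall>p\<in>Q. p \<le> q \<longrightarrow> p \<in> J)"

definition bistrict_chain :: "('a::order \<times> 'b::order) set \<Rightarrow> bool" where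
  "bistrict_chain C \<longleftrightarrow>
    Complete_Partial_Order.chain (\<le>) C \<and>
    (\<forall>(a, b) \<in> C. \<forall>(a', b') \<in> C. (a, b) < (a', b') \<longrightarrow> a < a' \<and> b < b')"

text \<open>
  The fiber of \<open>\<phi>\<close> over \<open>r\<close> as a subset of \<open>[n] \<times> P\<^sup>o\<^sup>p\<close>; the type constructor \<open>dual\<close>
  reverses the order.
\<close>

definition fiber_op :: "nat \<Rightarrow> 'p set \<Rightarrow> (nat \<times> 'p \<Rightarrow> 'r) \<Rightarrow> 'r \<Rightarrow> (nat \<times> 'p dual) set" where
  "fiber_op n P \<phi> r = {(i, dual p) | i p. i \<in> {1..n} \<and> p \<in> P \<and> \<phi> (i, p) = r}"


subsection \<open>Letterplace and co-letterplace ideals\<close>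

text \<open>\<open>L(P,n;J)\<close>\<close>

definition co_letterplace ::
    "'p::order set \<Rightarrow> nat \<Rightarrow> ('p \<Rightarrow> nat) set \<Rightarrow> ('p \<times> nat, 'k::field) mpoly set" where
  "co_letterplace P n J = Idl\<^bsub>poly_ring (P \<times> {1..n})\<^esub> {\<Prod>p\<in>P. Var (p, \<psi> p) | \<psi>. \<psi> \<in> J}"

text \<open>\<open>L(n,P;J)\<close>\<close>

definition letterplace ::
    "nat \<Rightarrow> 'p::order set \<Rightarrow> ('p \<Rightarrow> nat) set \<Rightarrow> (nat \<times> 'p, 'k::field) mpoly set" where
  "letterplace n P J =
    alexander_dual ({1..n} \<times> P) (var_map prod.swap ` co_letterplace P n J)"

text \<open>\<open>L\<^sup>\<phi>(n,P;J)\<close> and \<open>L\<^sup>\<phi>(P,n;J)\<close> as ideals of \<open>k[x\<^sub>R]\<close>\<close>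

definition letterplace_map ::
    "'r set \<Rightarrow> (nat \<times> 'p \<Rightarrow> 'r) \<Rightarrow> nat \<Rightarrow> 'p::order set \<Rightarrow> ('p \<Rightarrow> nat) set \<Rightarrow>
      ('r, 'k::field) mpoly set" where
  "letterplace_map R \<phi> n P J = Idl\<^bsub>poly_ring R\<^esub> (var_map \<phi> ` letterplace n P J)"

definition co_letterplace_map ::
    "'r set \<Rightarrow> ('p \<times> nat \<Rightarrow> 'r) \<Rightarrow> 'p::order set \<Rightarrow> nat \<Rightarrow> ('p \<Rightarrow> nat) set \<Rightarrow>
      ('r, 'k::field) mpoly set" where
  "co_letterplace_map R \<phi> P n J = Idl\<^bsub>poly_ring R\<^esub> (var_map \<phi> ` co_letterplace P n J)"

definition transpose_map :: "(nat \<times> 'p \<Rightarrow> 'r) \<Rightarrow> 'p \<times> nat \<Rightarrow> 'r" where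
  "transpose_map \<phi> = (\<lambda>(p, i). \<phi> (i, p))"

end

theory Submission
  imports Defs
begin

text \<open>
  The ideals to be compared are spanned by the monomials whose support contains a member of some family
  of finite sets. For the ideal of a family \<open>\<F>\<close>, the Alexander dual is the ideal of the family of
  transversals of \<open>\<F>\<close>, and for finite \<open>\<F>\<close> taking transversals twice returns to \<open>\<F>\<close> up to
  supersets (\<open>are_alexander_dual_transversals\<close>). So the claim becomes one about transversals.

  Let \<open>\<G>\<close> be the family of graphs \<open>{(\<psi> p, p) | p \<in> P}\<close> with \<open>\<psi> \<in> J\<close>. The map \<open>\<phi>\<close> is injective on
  each graph: two distinct points of a fiber form an inversion, \<open>i < j\<close> and \<open>q < p\<close>, which the graph of an
  isotone map cannot contain. Hence the second ideal belongs to the family \<open>\<phi> ` \<G>\<close>. A finite set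
  \<open>W \<subseteq> R\<close> is a transversal of \<open>\<phi> ` \<G>\<close> iff its preimage is a transversal of \<open>\<G>\<close>, so the dual of
  the second ideal has the same radical as the first one. The two coincide provided that the first
  is generated by squarefree monomials, that is, provided that each transversal of \<open>\<G>\<close> contains
  one on which \<open>\<phi>\<close> is injective.

  This is the combinatorial core. In a minimal transversal \<open>T\<close>, each \<open>t \<in> T\<close> is the only point of
  \<open>T\<close> on the graph of some map in \<open>J\<close>. If \<open>T\<close> contained an inversion, the two maps belonging to its
  points could be spliced into a map in \<open>J\<close> whose graph misses \<open>T\<close> altogether
  (\<open>minimal_transversal_no_inversion\<close>). So minimal transversals meet each fiber at most once.
\<close>


section \<open>Ideals spanned by monomials of prescribed support\<close>

definition supp_ideal :: "'a set \<Rightarrow> 'a set set \<Rightarrow> ('a, 'k::field) mpoly set" where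
  "supp_ideal A \<F> =
    {f. \<forall>m \<in> Poly_Mapping.keys f.
      Poly_Mapping.keys m \<subseteq> A \<and> (\<exists>F\<in>\<F>. F \<subseteq> Poly_Mapping.keys m)}"

definition sqfree :: "'a set \<Rightarrow> ('a, 'k::field) mpoly" where
  "sqfree S = (\<Prod>a\<in>S. Var a)"

definition indicator_exp :: "'a set \<Rightarrow> 'a \<Rightarrow>\<^sub>0 nat" where
  "indicator_exp S = (\<Sum>a\<in>S. Poly_Mapping.single a 1)"

lemma keys_add_nat:
  fixes u v :: "'a \<Rightarrow>\<^sub>0 nat"
  shows "Poly_Mapping.keys (u + v) = Poly_Mapping.keys u \<union> Poly_Mapping.keys v"
  by (auto simp: in_keys_iff lookup_add)

lemma keys_sum_single:
  fixes e :: "'a \<Rightarrow> nat"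
  assumes "finite S" "\<And>a. a \<in> S \<Longrightarrow> e a \<noteq> 0"
  shows "Poly_Mapping.keys (\<Sum>a\<in>S. Poly_Mapping.single (g a) (e a)) = g ` S"
  using assms
proof (induction S rule: finite_induct)
  case (insert a S)
  have "e a \<noteq> 0" using insert.prems by blast
  moreover have "Poly_Mapping.keys (\<Sum>a\<in>S. Poly_Mapping.single (g a) (e a)) = g ` S"
    using insert.IH insert.prems by blast
  ultimately show ?case using insert.hyps by (simp add: keys_add_nat)
qed simp

lemma keys_indicator_exp: "finite S \<Longrightarrow> Poly_Mapping.keys (indicator_exp S) = S"
  unfolding indicator_exp_def using keys_sum_single[of S "\<lambda>_. 1" "\<lambda>a. a"] by simp

lemma lookup_indicator_exp:
  "finite S \<Longrightarrow> Poly_Mapping.lookup (indicator_exp S) a = (if a \<in> S then 1 else 0)"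
  by (induction S rule: finite_induct)
    (auto simp: indicator_exp_def lookup_add lookup_single when_def)

lemma Var_power:
  "(Var a :: ('a, 'k::field) mpoly) ^ e = Poly_Mapping.single (Poly_Mapping.single a e) 1"
  by (induction e) (auto simp: Var_def mult_single single_add[symmetric])

lemma prod_single_one:
  "(\<Prod>a\<in>S. Poly_Mapping.single (h a) (1::'k::field)) =
    Poly_Mapping.single (\<Sum>a\<in>S. h a) 1"
  by (induction S rule: infinite_finite_induct) (auto simp: mult_single)

lemma sqfree_eq_single: "sqfree S = Poly_Mapping.single (indicator_exp S) 1"
  by (simp add: sqfree_def indicator_exp_def Var_def prod_single_one)

lemma sum_single_lookup:
  "(\<Sum>m\<in>Poly_Mapping.keys f. Poly_Mapping.single m (Poly_Mapping.lookup f m)) = f"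
  by (rule poly_mapping_eqI) (simp add: lookup_sum lookup_single when_def in_keys_iff)

lemma supp_ideal_carrier: "supp_ideal A \<F> \<subseteq> carrier (poly_ring A)"
  by (auto simp: supp_ideal_def poly_ring_def)

lemma single_in_supp_ideal:
  "(Poly_Mapping.single m 1 :: ('a, 'k::field) mpoly) \<in> supp_ideal A \<F> \<longleftrightarrow>
    Poly_Mapping.keys m \<subseteq> A \<and> (\<exists>F\<in>\<F>. F \<subseteq> Poly_Mapping.keys m)"
  by (auto simp: supp_ideal_def)

lemma ideal_supp_ideal:
  "ideal (supp_ideal A \<F> :: ('a, 'k::field) mpoly set) (poly_ring A)"
proof -
  interpret R: cring "poly_ring A :: ('a, 'k) mpoly ring" by (rule cring_poly_ring)
  let ?I = "supp_ideal A \<F> :: ('a, 'k) mpoly set"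
  have add: "f + g \<in> ?I" if "f \<in> ?I" "g \<in> ?I" for f g
    using that Poly_Mapping.keys_add[of f g] unfolding supp_ideal_def by blast
  have mult: "f * g \<in> ?I" if "f \<in> ?I" "g \<in> carrier (poly_ring A)" for f g
    unfolding supp_ideal_def
  proof (intro CollectI ballI)
    fix m assume "m \<in> Poly_Mapping.keys (f * g)"
    then obtain u v where "u \<in> Poly_Mapping.keys f" "v \<in> Poly_Mapping.keys g" "m = u + v"
      using Poly_Mapping.keys_mult[of f g] by blast
    moreover from this that have "Poly_Mapping.keys u \<subseteq> A" "Poly_Mapping.keys v \<subseteq> A"
        "\<exists>F\<in>\<F>. F \<subseteq> Poly_Mapping.keys u"
      by (auto simp: supp_ideal_def poly_ring_def)
    ultimately show "Poly_Mapping.keys m \<subseteq> A \<and> (\<exists>F\<in>\<F>. F \<subseteq> Poly_Mapping.keys m)"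
      by (auto simp: keys_add_nat)
  qed
  have inv: "\<ominus>\<^bsub>poly_ring A\<^esub> f = - f" if "f \<in> ?I" for f
  proof (rule R.minus_equality)
    show "f \<in> carrier (poly_ring A)" using that supp_ideal_carrier by blast
    then show "- f \<in> carrier (poly_ring A)" by (simp add: poly_ring_def)
  qed (simp add: poly_ring_def)
  have sub: "subgroup ?I (add_monoid (poly_ring A))"
  proof (rule R.add.subgroupI)
    show "?I \<subseteq> carrier (poly_ring A)" by (rule supp_ideal_carrier)
    have "0 \<in> ?I" by (simp add: supp_ideal_def)
    then show "?I \<noteq> {}" by blast
    fix f assume f: "f \<in> ?I"
    have "- f \<in> ?I" using f by (simp add: supp_ideal_def)
    with inv[OF f] show "\<ominus>\<^bsub>poly_ring A\<^esub> f \<in> ?I" by simp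
    fix g assume g: "g \<in> ?I"
    from add[OF f g] show "f \<oplus>\<^bsub>poly_ring A\<^esub> g \<in> ?I" by (simp add: poly_ring_def)
  qed
  show ?thesis
  proof (rule idealI)
    show "ring (poly_ring A :: ('a, 'k) mpoly ring)" by (rule R.ring_axioms)
    show "subgroup ?I (add_monoid (poly_ring A))" by (rule sub)
    fix f g :: "('a, 'k) mpoly" assume "f \<in> ?I" "g \<in> carrier (poly_ring A)"
    from mult[OF this]
    show "g \<otimes>\<^bsub>poly_ring A\<^esub> f \<in> ?I" "f \<otimes>\<^bsub>poly_ring A\<^esub> g \<in> ?I"
      by (simp_all add: poly_ring_def mult.commute)
  qed
qed

text \<open>
  Only the squarefree generators matter, so the same criterion covers ideals given by squarefree
  generators, by all the monomials of the dual, and by images under a map of variables.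
\<close>

lemma genideal_eq_supp_ideal:
  fixes M :: "('a, 'k::field) mpoly set"
  assumes fin: "\<And>F. F \<in> \<F> \<Longrightarrow> finite F"
    and lower: "sqfree ` \<F> \<subseteq> M" and upper: "M \<subseteq> supp_ideal A \<F>"
  shows "Idl\<^bsub>poly_ring A\<^esub> M = supp_ideal A \<F>"
proof
  interpret R: cring "poly_ring A :: ('a, 'k) mpoly ring" by (rule cring_poly_ring)
  show "Idl\<^bsub>poly_ring A\<^esub> M \<subseteq> supp_ideal A \<F>"
    using ideal_supp_ideal upper by (rule R.genideal_minimal)
  have MC: "M \<subseteq> carrier (poly_ring A)" using upper supp_ideal_carrier by blast
  interpret I: ideal "Idl\<^bsub>poly_ring A\<^esub> M" "poly_ring A"
    using MC by (rule R.genideal_ideal)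
  have MI: "M \<subseteq> Idl\<^bsub>poly_ring A\<^esub> M" using MC by (rule R.genideal_self)
  show "supp_ideal A \<F> \<subseteq> Idl\<^bsub>poly_ring A\<^esub> M"
  proof
    fix f :: "('a, 'k) mpoly" assume f: "f \<in> supp_ideal A \<F>"
    let ?t = "\<lambda>m. Poly_Mapping.single m (Poly_Mapping.lookup f m) :: ('a, 'k) mpoly"
    have term_in: "?t m \<in> Idl\<^bsub>poly_ring A\<^esub> M" if m: "m \<in> Poly_Mapping.keys f" for m
    proof -
      from f m obtain F where F: "F \<in> \<F>" "F \<subseteq> Poly_Mapping.keys m"
        and mA: "Poly_Mapping.keys m \<subseteq> A" by (auto simp: supp_ideal_def)
      let ?w = "m - indicator_exp F"
      have split: "m = ?w + indicator_exp F"
      proof (rule poly_mapping_eqI)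
        fix a
        have "a \<in> F \<Longrightarrow> Poly_Mapping.lookup m a \<noteq> 0" using F(2) by (auto simp: in_keys_iff)
        then show "Poly_Mapping.lookup m a = Poly_Mapping.lookup (?w + indicator_exp F) a"
          by (auto simp: lookup_add lookup_minus lookup_indicator_exp fin[OF F(1)])
      qed
      have "Poly_Mapping.keys ?w \<subseteq> A"
        using mA split by (metis keys_add_nat le_sup_iff)
      then have c: "Poly_Mapping.single ?w (Poly_Mapping.lookup f m) \<in> carrier (poly_ring A)"
        by (auto simp: poly_ring_def)
      have "sqfree F \<in> Idl\<^bsub>poly_ring A\<^esub> M" using F(1) lower MI by blast
      from I.I_l_closed[OF this c] show ?thesis
        using split by (simp add: poly_ring_def sqfree_eq_single mult_single)
    qed
    have "sum ?t S \<in> Idl\<^bsub>poly_ring A\<^esub> M" if "finite S" "S \<subseteq> Poly_Mapping.keys f" for S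
      using that
    proof (induction S rule: finite_induct)
      case empty
      show ?case using I.zero_closed by (simp add: poly_ring_def)
    next
      case (insert m S)
      then show ?case using I.a_closed[OF term_in[of m]] by (simp add: poly_ring_def)
    qed
    then have "sum ?t (Poly_Mapping.keys f) \<in> Idl\<^bsub>poly_ring A\<^esub> M" by simp
    then show "f \<in> Idl\<^bsub>poly_ring A\<^esub> M" by (simp add: sum_single_lookup)
  qed
qed

lemma sqfree_in_supp_ideal:
  assumes "finite F" "F \<subseteq> A" "F \<in> \<F>"
  shows "sqfree F \<in> supp_ideal A \<F>"
  using assms by (auto simp: sqfree_eq_single single_in_supp_ideal keys_indicator_exp)

text \<open>
  An ideal depends only on the upward closure of the family; this is how a family is replaced by
  its minimal members.
\<close>

lemma supp_ideal_eqI: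
  assumes "\<And>F. F \<in> \<F> \<Longrightarrow> \<exists>G\<in>\<G>. G \<subseteq> F" "\<And>G. G \<in> \<G> \<Longrightarrow> \<exists>F\<in>\<F>. F \<subseteq> G"
  shows "supp_ideal A \<F> = supp_ideal A \<G>"
proof -
  have "(\<exists>F\<in>\<F>. F \<subseteq> X) \<longleftrightarrow> (\<exists>G\<in>\<G>. G \<subseteq> X)" for X
    using assms by (meson order_trans)
  then show ?thesis by (simp add: supp_ideal_def)
qed

lemma squarefree_monomial_ideal_supp_ideal:
  assumes "\<And>F. F \<in> \<F> \<Longrightarrow> finite F \<and> F \<subseteq> A"
  shows "squarefree_monomial_ideal A (supp_ideal A \<F> :: ('a, 'k::field) mpoly set)"
  unfolding squarefree_monomial_ideal_def
proof (intro exI conjI)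
  show "sqfree ` \<F> \<subseteq> (squarefree_monomials A :: ('a, 'k) mpoly set)"
    using assms by (auto simp: squarefree_monomials_def sqfree_def)
  show "supp_ideal A \<F> = Idl\<^bsub>poly_ring A\<^esub> (sqfree ` \<F> :: ('a, 'k) mpoly set)"
    using assms by (intro genideal_eq_supp_ideal[symmetric]) (auto intro: sqfree_in_supp_ideal)
qed


section \<open>Alexander duality as transversality of supports\<close>

definition transversals :: "'a set \<Rightarrow> 'a set set \<Rightarrow> 'a set set" where
  "transversals A \<F> = {T. finite T \<and> T \<subseteq> A \<and> (\<forall>F\<in>\<F>. T \<inter> F \<noteq> {})}"

lemma single_dvd_imp_keys_subset:
  assumes "(Poly_Mapping.single d 1 :: ('a, 'k::field) mpoly) dvd Poly_Mapping.single u 1"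
  shows "Poly_Mapping.keys d \<subseteq> Poly_Mapping.keys u"
proof -
  obtain f where f: "Poly_Mapping.single u (1::'k) = Poly_Mapping.single d 1 * f"
    using assms by (auto simp: dvd_def)
  have "u \<in> Poly_Mapping.keys (Poly_Mapping.single d (1::'k) * f)"
    unfolding f[symmetric] by simp
  then obtain w where "u = d + w"
    using Poly_Mapping.keys_mult[of "Poly_Mapping.single d (1::'k)" f] by auto
  then show ?thesis by (simp add: keys_add_nat)
qed

lemma Var_dvd_single:
  assumes "a \<in> Poly_Mapping.keys u"
  shows "(Var a :: ('a, 'k::field) mpoly) dvd Poly_Mapping.single u 1"
proof
  have "u = Poly_Mapping.single a 1 + (u - Poly_Mapping.single a 1)"
    using assms by (intro poly_mapping_eqI)
      (auto simp: lookup_add lookup_minus lookup_single when_def in_keys_iff)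
  then show "Poly_Mapping.single u 1 =
      Var a * Poly_Mapping.single (u - Poly_Mapping.single a 1) (1::'k)"
    unfolding Var_def mult_single mult_1 by (rule arg_cong)
qed

lemma common_divisor_iff_keys_meet:
  assumes "Poly_Mapping.keys u \<subseteq> A"
  shows "(\<exists>d \<in> monomials A. d \<noteq> 1 \<and> d dvd (Poly_Mapping.single u 1 :: ('a, 'k::field) mpoly) \<and>
      d dvd Poly_Mapping.single v 1) \<longleftrightarrow> Poly_Mapping.keys u \<inter> Poly_Mapping.keys v \<noteq> {}"
    (is "?L \<longleftrightarrow> ?R")
proof
  assume ?L
  then obtain d where d: "Poly_Mapping.single d (1::'k) \<noteq> 1"
    "Poly_Mapping.single d (1::'k) dvd Poly_Mapping.single u 1"
    "Poly_Mapping.single d (1::'k) dvd Poly_Mapping.single v 1"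
    by (auto simp: monomials_def)
  from d(1) have "d \<noteq> 0" by auto
  then have "Poly_Mapping.keys d \<noteq> {}" by simp
  with d(2,3)[THEN single_dvd_imp_keys_subset] show ?R by blast
next
  assume ?R
  then obtain a where a: "a \<in> Poly_Mapping.keys u" "a \<in> Poly_Mapping.keys v" by blast
  have "Poly_Mapping.single a (1::nat) \<noteq> 0"
    by (metis insert_not_empty keys_single keys_zero zero_neq_one)
  then have "Poly_Mapping.keys (Var a :: ('a, 'k) mpoly) \<noteq> Poly_Mapping.keys 1"
    by (simp add: Var_def)
  then have ne: "(Var a :: ('a, 'k) mpoly) \<noteq> 1" by metis
  have mon: "(Var a :: ('a, 'k) mpoly) \<in> monomials A"
    using a assms by (auto simp: monomials_def Var_def intro!: exI[of _ "Poly_Mapping.single a 1"])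
  show ?L
    by (rule bexI[OF _ mon]) (intro conjI ne Var_dvd_single a)
qed

text \<open>
  The set \<open>I\<close> need not be an ideal: the dual is determined by the monomials in \<open>I\<close>, and among these
  by the \<open>sqfree F\<close> with \<open>F \<in> \<F>\<close>. This permits duals of images under renamings of variables.
\<close>

lemma alexander_dual_eq_supp_ideal:
  fixes I :: "('a, 'k::field) mpoly set"
  assumes \<F>: "\<And>F. F \<in> \<F> \<Longrightarrow> finite F \<and> F \<subseteq> A"
    and lower: "sqfree ` \<F> \<subseteq> I" and upper: "I \<subseteq> supp_ideal A \<F>"
  shows "alexander_dual A I = supp_ideal A (transversals A \<F>)"
proof -
  have *: "(\<forall>v \<in> monomials A \<inter> I. \<exists>d \<in> monomials A. d \<noteq> 1 \<and> d dvd Poly_Mapping.single u 1 \<and> d dvd v)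
      \<longleftrightarrow> Poly_Mapping.keys u \<in> transversals A \<F>" (is "?L \<longleftrightarrow> ?R")
    if u: "Poly_Mapping.keys u \<subseteq> A" for u
  proof
    assume L: ?L
    have "Poly_Mapping.keys u \<inter> F \<noteq> {}" if F: "F \<in> \<F>" for F
    proof -
      have "sqfree F \<in> (monomials A :: ('a, 'k) mpoly set)"
        using \<F>[OF F] by (auto simp: monomials_def sqfree_eq_single keys_indicator_exp
            intro!: exI[of _ "indicator_exp F"])
      then have "\<exists>d \<in> monomials A. d \<noteq> 1 \<and> d dvd Poly_Mapping.single u 1 \<and>
          d dvd (sqfree F :: ('a, 'k) mpoly)"
        using L F lower by blast
      then show ?thesis
        unfolding sqfree_eq_single common_divisor_iff_keys_meet[OF u]
        using \<F>[OF F] by (simp add: keys_indicator_exp)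
    qed
    then show ?R using u by (simp add: transversals_def)
  next
    assume R: ?R
    show ?L
    proof
      fix v assume v: "v \<in> monomials A \<inter> I"
      then obtain w where w: "v = Poly_Mapping.single w 1" by (auto simp: monomials_def)
      with v upper obtain F where "F \<in> \<F>" "F \<subseteq> Poly_Mapping.keys w"
        using single_in_supp_ideal[of w A \<F>] by blast
      with R have "Poly_Mapping.keys u \<inter> Poly_Mapping.keys w \<noteq> {}"
        unfolding transversals_def by blast
      then show "\<exists>d \<in> monomials A. d \<noteq> 1 \<and> d dvd Poly_Mapping.single u 1 \<and> d dvd v"
        unfolding w common_divisor_iff_keys_meet[OF u] .
    qed
  qed
  define X where "X = {u \<in> monomials A. \<forall>v \<in> monomials A \<inter> I.
    \<exists>d \<in> monomials A. d \<noteq> 1 \<and> d dvd u \<and> d dvd v}"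
  have in_X: "Poly_Mapping.single u 1 \<in> X \<longleftrightarrow> Poly_Mapping.keys u \<in> transversals A \<F>"
    if u: "Poly_Mapping.keys u \<subseteq> A" for u
  proof -
    have "(Poly_Mapping.single u 1 :: ('a, 'k) mpoly) \<in> monomials A"
      using u unfolding monomials_def by blast
    then show ?thesis unfolding X_def mem_Collect_eq using *[OF u] by simp
  qed
  have "Idl\<^bsub>poly_ring A\<^esub> X = supp_ideal A (transversals A \<F>)"
  proof (rule genideal_eq_supp_ideal)
    show "finite T" if "T \<in> transversals A \<F>" for T using that by (simp add: transversals_def)
    show "sqfree ` transversals A \<F> \<subseteq> X"
    proof (rule image_subsetI)
      fix T assume T: "T \<in> transversals A \<F>"
      then have "Poly_Mapping.keys (indicator_exp T) = T" "T \<subseteq> A"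
        by (auto simp: transversals_def keys_indicator_exp)
      with T show "sqfree T \<in> X" using in_X[of "indicator_exp T"] by (simp add: sqfree_eq_single)
    qed
    show "X \<subseteq> supp_ideal A (transversals A \<F>)"
    proof
      fix u assume u: "u \<in> X"
      then obtain m where m: "u = Poly_Mapping.single m 1" "Poly_Mapping.keys m \<subseteq> A"
        by (auto simp: X_def monomials_def)
      with u in_X[OF m(2)] show "u \<in> supp_ideal A (transversals A \<F>)"
        by (auto simp: single_in_supp_ideal)
    qed
  qed
  then show ?thesis by (simp add: alexander_dual_def X_def)
qed

lemma alexander_dual_supp_ideal:
  assumes "\<And>F. F \<in> \<F> \<Longrightarrow> finite F \<and> F \<subseteq> A"
  shows "alexander_dual A (supp_ideal A \<F>) = supp_ideal A (transversals A \<F>)"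
  using assms by (intro alexander_dual_eq_supp_ideal) (auto intro: sqfree_in_supp_ideal)

text \<open>
  The double dual returns to the original ideal by complementation: if \<open>V\<close> contains no member of
  \<open>\<F>\<close>, then \<open>\<Union>\<F> - V\<close> is a transversal of \<open>\<F>\<close> disjoint from \<open>V\<close>. Finiteness of \<open>\<F>\<close> makes this
  the support of a monomial.
\<close>

lemma are_alexander_dual_transversals:
  assumes "finite \<F>" and \<F>: "\<And>F. F \<in> \<F> \<Longrightarrow> finite F \<and> F \<subseteq> A"
  shows "are_alexander_dual A (supp_ideal A (transversals A \<F>) :: ('a, 'k::field) mpoly set)
    (supp_ideal A \<F>)"
proof -
  have T: "finite T \<and> T \<subseteq> A" if "T \<in> transversals A \<F>" for T
    using that by (simp add: transversals_def)
  have "supp_ideal A (transversals A (transversals A \<F>)) =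
      (supp_ideal A \<F> :: ('a, 'k) mpoly set)"
  proof (rule supp_ideal_eqI)
    fix V assume V: "V \<in> transversals A (transversals A \<F>)"
    show "\<exists>F\<in>\<F>. F \<subseteq> V"
    proof (rule ccontr)
      assume "\<not> (\<exists>F\<in>\<F>. F \<subseteq> V)"
      then have "(\<Union>\<F> - V) \<inter> F \<noteq> {}" if "F \<in> \<F>" for F
        using that by blast
      moreover have "finite (\<Union>\<F>)" "\<Union>\<F> \<subseteq> A" using assms by auto
      ultimately have "\<Union>\<F> - V \<in> transversals A \<F>"
        unfolding transversals_def by blast
      with V show False by (auto simp: transversals_def)
    qed
  next
    fix F assume "F \<in> \<F>"
    then have "F \<in> transversals A (transversals A \<F>)"
      using \<F> by (auto simp: transversals_def)
    then show "\<exists>V\<in>transversals A (transversals A \<F>). V \<subseteq> F" by blast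
  qed
  then show ?thesis
    unfolding are_alexander_dual_def
    using \<F> T by (simp add: squarefree_monomial_ideal_supp_ideal alexander_dual_supp_ideal)
qed


section \<open>Identifying variables\<close>

lemma var_map_eq_sum:
  "var_map g f = (\<Sum>m \<in> Poly_Mapping.keys f. Poly_Mapping.single
    (\<Sum>a \<in> Poly_Mapping.keys m. Poly_Mapping.single (g a) (Poly_Mapping.lookup m a))
    (Poly_Mapping.lookup f m))"
  by (simp add: var_map_def Const_def Var_power prod_single_one mult_single)

lemma keys_var_map:
  assumes "w \<in> Poly_Mapping.keys (var_map g f)"
  obtains m where "m \<in> Poly_Mapping.keys f" "Poly_Mapping.keys w = g ` Poly_Mapping.keys m"
proof -
  from assms obtain m where m: "m \<in> Poly_Mapping.keys f"
    "w \<in> Poly_Mapping.keys (Poly_Mapping.single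
      (\<Sum>a \<in> Poly_Mapping.keys m. Poly_Mapping.single (g a) (Poly_Mapping.lookup m a))
      (Poly_Mapping.lookup f m))"
    unfolding var_map_eq_sum using Poly_Mapping.keys_sum by fastforce
  then have "w = (\<Sum>a \<in> Poly_Mapping.keys m. Poly_Mapping.single (g a) (Poly_Mapping.lookup m a))"
    by (simp split: if_splits)
  then have "Poly_Mapping.keys w = g ` Poly_Mapping.keys m"
    using keys_sum_single[of "Poly_Mapping.keys m" "Poly_Mapping.lookup m" g]
    by (simp add: in_keys_iff)
  with m(1) show thesis by (rule that)
qed

lemma var_map_sqfree:
  assumes "finite S" "inj_on g S"
  shows "var_map g (sqfree S) = sqfree (g ` S)"
proof -
  have "(\<Sum>a\<in>S. Poly_Mapping.single (g a) (Poly_Mapping.lookup (indicator_exp S) a)) =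
      indicator_exp (g ` S)"
    unfolding indicator_exp_def[of "g ` S"] sum.reindex[OF assms(2)] comp_def
    by (rule sum.cong) (simp_all add: lookup_indicator_exp assms(1))
  then show ?thesis
    by (simp add: var_map_eq_sum sqfree_eq_single keys_indicator_exp[OF assms(1)])
qed

text \<open>
  These are the two hypotheses of \<open>genideal_eq_supp_ideal\<close> and \<open>alexander_dual_eq_supp_ideal\<close> for
  an image. Injectivity on the members of the family keeps the images of the generators squarefree;
  without it the image of \<open>sqfree F\<close> has an exponent larger than one.
\<close>

lemma var_map_image_sandwich:
  assumes fin: "\<And>F. F \<in> \<F> \<Longrightarrow> finite F" and inj: "\<And>F. F \<in> \<F> \<Longrightarrow> inj_on g F"
    and g: "g ` A \<subseteq> B" and lower: "sqfree ` \<F> \<subseteq> I" and upper: "I \<subseteq> supp_ideal A \<F>"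
  shows "sqfree ` (`) g ` \<F> \<subseteq> var_map g ` I" "var_map g ` I \<subseteq> supp_ideal B ((`) g ` \<F>)"
proof -
  show "sqfree ` (`) g ` \<F> \<subseteq> var_map g ` I"
    unfolding image_image
  proof (rule image_subsetI)
    fix F assume F: "F \<in> \<F>"
    with lower have "sqfree F \<in> I" by blast
    then show "sqfree (g ` F) \<in> var_map g ` I"
      unfolding var_map_sqfree[OF fin[OF F] inj[OF F], symmetric] by (rule imageI)
  qed
  show "var_map g ` I \<subseteq> supp_ideal B ((`) g ` \<F>)"
  proof
    fix h assume "h \<in> var_map g ` I"
    then obtain f where f: "f \<in> supp_ideal A \<F>" "h = var_map g f" using upper by blast
    show "h \<in> supp_ideal B ((`) g ` \<F>)"
      unfolding supp_ideal_def
    proof (intro CollectI ballI)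
      fix w assume "w \<in> Poly_Mapping.keys h"
      then obtain m where m: "m \<in> Poly_Mapping.keys f"
        "Poly_Mapping.keys w = g ` Poly_Mapping.keys m"
        using f(2) keys_var_map by metis
      with f(1) obtain F where F: "F \<in> \<F>" "F \<subseteq> Poly_Mapping.keys m" "Poly_Mapping.keys m \<subseteq> A"
        unfolding supp_ideal_def by blast
      then have "g ` F \<subseteq> Poly_Mapping.keys w" "Poly_Mapping.keys w \<subseteq> B"
        unfolding m(2) using g by blast+
      with F(1) show "Poly_Mapping.keys w \<subseteq> B \<and> (\<exists>G\<in>(`) g ` \<F>. G \<subseteq> Poly_Mapping.keys w)"
        by blast
    qed
  qed
qed

lemma genideal_var_map_supp_ideal:
  assumes \<F>: "\<And>F. F \<in> \<F> \<Longrightarrow> finite F \<and> F \<subseteq> A" and inj: "\<And>F. F \<in> \<F> \<Longrightarrow> inj_on g F"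
    and g: "g ` A \<subseteq> B"
  shows "Idl\<^bsub>poly_ring B\<^esub> (var_map g ` supp_ideal A \<F>) = supp_ideal B ((`) g ` \<F>)"
proof -
  have "sqfree ` \<F> \<subseteq> supp_ideal A \<F>" using \<F> by (auto intro: sqfree_in_supp_ideal)
  with \<F> inj g show ?thesis
    by (intro genideal_eq_supp_ideal var_map_image_sandwich) auto
qed


section \<open>Minimal transversals of graphs of isotone maps\<close>

text \<open>
  The coordinates are ordered as in \<open>[n] \<times> P\<close>, the domain of \<open>\<phi>\<close>, so that no transposition is
  needed when transversals are formed.
\<close>

definition graph :: "'p set \<Rightarrow> ('p \<Rightarrow> nat) \<Rightarrow> (nat \<times> 'p) set" where
  "graph P \<psi> = (\<lambda>p. (\<psi> p, p)) ` P"

text \<open>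
  Let \<open>\<alpha>\<close> and \<open>\<beta>\<close> in \<open>J\<close> have graphs that meet \<open>T\<close> only in \<open>(i, p)\<close> and only in \<open>(j, q)\<close>,
  respectively. Then \<open>\<alpha> q \<le> \<alpha> p = i < j = \<beta> q\<close>. Take \<open>\<beta>\<close> on the elements above \<open>p\<close> and
  \<open>min \<alpha> \<beta>\<close> elsewhere. The result is isotone and at most \<open>\<beta>\<close>, hence in \<open>J\<close>; it avoids \<open>(i, p)\<close>
  because it follows \<open>\<beta>\<close> at \<open>p\<close>, and \<open>(j, q)\<close> because it follows \<open>\<alpha>\<close> at \<open>q\<close>. Its graph thus
  misses \<open>T\<close>.
\<close>

lemma minimal_transversal_no_inversion:
  fixes P :: "'p::order set"
  assumes J: "poset_ideal (Hom_chain P n) J"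
    and T: "\<And>\<psi>. \<psi> \<in> J \<Longrightarrow> T \<inter> graph P \<psi> \<noteq> {}"
    and min: "\<And>t. t \<in> T \<Longrightarrow> \<exists>\<psi>\<in>J. (T - {t}) \<inter> graph P \<psi> = {}"
    and in_T: "(i, p) \<in> T" "(j, q) \<in> T" and "i < j" "q < p"
  shows False
proof -
  obtain \<alpha> where \<alpha>: "\<alpha> \<in> J" "(T - {(i, p)}) \<inter> graph P \<alpha> = {}" using min in_T(1) by blast
  obtain \<beta> where \<beta>: "\<beta> \<in> J" "(T - {(j, q)}) \<inter> graph P \<beta> = {}" using min in_T(2) by blast
  have "(i, p) \<in> graph P \<alpha>" using T[OF \<alpha>(1)] \<alpha>(2) by blast
  then have p: "p \<in> P" "\<alpha> p = i" by (auto simp: graph_def)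
  have "(j, q) \<in> graph P \<beta>" using T[OF \<beta>(1)] \<beta>(2) by blast
  then have q: "q \<in> P" "\<beta> q = j" by (auto simp: graph_def)
  have \<alpha>H: "\<alpha> \<in> P \<rightarrow>\<^sub>E {1..n}" "mono_on P \<alpha>" and \<beta>H: "\<beta> \<in> P \<rightarrow>\<^sub>E {1..n}" "mono_on P \<beta>"
    using \<alpha>(1) \<beta>(1) J by (auto simp: poset_ideal_def Hom_chain_def)
  have "\<alpha> q \<le> i" using \<alpha>H(2) p q \<open>q < p\<close> by (auto dest: mono_onD)
  then have \<alpha>q: "\<alpha> q < \<beta> q" using q \<open>i < j\<close> by simp
  \<comment> \<open>Outside \<open>P\<close> the value is that of \<open>\<beta>\<close>, the default value of extensional functions.\<close>
  define \<gamma> where "\<gamma> x = (if x \<in> P \<and> \<not> p \<le> x then min (\<alpha> x) (\<beta> x) else \<beta> x)" for x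
  have le: "\<gamma> \<le> \<beta>" by (auto simp: \<gamma>_def le_fun_def)
  have "mono_on P \<gamma>"
  proof (rule mono_onI)
    fix x y assume xy: "x \<in> P" "y \<in> P" "x \<le> y"
    then have "\<alpha> x \<le> \<alpha> y" "\<beta> x \<le> \<beta> y" using \<alpha>H(2) \<beta>H(2) by (auto dest: mono_onD)
    with xy show "\<gamma> x \<le> \<gamma> y" by (auto simp: \<gamma>_def)
  qed
  moreover have "\<gamma> \<in> P \<rightarrow>\<^sub>E {1..n}"
    using \<alpha>H(1) \<beta>H(1) by (auto simp: \<gamma>_def PiE_iff extensional_def min_def)
  ultimately have "\<gamma> \<in> J" using J \<beta>(1) le by (auto simp: poset_ideal_def Hom_chain_def)
  then obtain x where x: "x \<in> P" "(\<gamma> x, x) \<in> T" using T by (fastforce simp: graph_def)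
  show False
  proof (cases "\<gamma> x = \<beta> x \<and> x \<noteq> q")
    case True
    then show False using x \<beta>(2) by (auto simp: graph_def)
  next
    case False
    have "\<not> p \<le> q" using \<open>q < p\<close> by (simp add: less_le_not_le)
    then have "\<gamma> x = \<alpha> x" "x \<noteq> p" using False \<alpha>q x(1) by (auto simp: \<gamma>_def min_def split: if_splits)
    then show False using x \<alpha>(2) by (auto simp: graph_def)
  qed
qed

lemma bistrict_fiber_inversion:
  assumes "bistrict_chain (fiber_op n P \<phi> r)"
    and "i \<in> {1..n}" "p \<in> P" "\<phi> (i, p) = r" "j \<in> {1..n}" "q \<in> P" "\<phi> (j, q) = r"
    and ne: "(i, p) \<noteq> (j, q)"
  shows "i < j \<and> q < p \<or> j < i \<and> p < q"
proof -
  let ?C = "fiber_op n P \<phi> r"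
  have mem: "(i, dual p) \<in> ?C" "(j, dual q) \<in> ?C"
    using assms by (auto simp: fiber_op_def)
  then have "(i, dual p) \<le> (j, dual q) \<or> (j, dual q) \<le> (i, dual p)"
    using assms(1) unfolding bistrict_chain_def chain_def by blast
  moreover have "(i, dual p) \<noteq> (j, dual q)" using ne by (auto simp: dual_eq_iff)
  ultimately have "(i, dual p) < (j, dual q) \<or> (j, dual q) < (i, dual p)"
    by (auto simp: order.order_iff_strict)
  then have "i < j \<and> dual p < dual q \<or> j < i \<and> dual q < dual p"
    using assms(1) mem unfolding bistrict_chain_def by blast
  then show ?thesis by (simp add: dual_less_iff less_dual_def)
qed

lemma finite_minimal_subset:
  assumes "finite S" "Q S"
  obtains T where "T \<subseteq> S" "Q T" "\<And>t. t \<in> T \<Longrightarrow> \<not> Q (T - {t})"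
proof -
  let ?X = "{T. T \<subseteq> S \<and> Q T}"
  have "finite ?X" "?X \<noteq> {}" using assms by auto
  then obtain T where T: "T \<in> ?X" "\<forall>U\<in>?X. U \<subseteq> T \<longrightarrow> T = U"
    using finite_has_minimal[of ?X] by auto
  have "\<not> Q (T - {t})" if "t \<in> T" for t
  proof
    assume "Q (T - {t})"
    then have "T - {t} \<in> ?X" using T(1) by blast
    then have "T = T - {t}" using T(2) by blast
    with that show False by blast
  qed
  then show thesis using T(1) that by blast
qed

text \<open>
  A transversal that is minimal under inclusion has no inversions, whereas two distinct elements
  with the same image under \<open>\<phi>\<close> would form one. So the Alexander dual is generated by squarefree
  monomials that stay squarefree after the variables are identified.
\<close>

lemma transversal_contains_injective:
  fixes P :: "'p::order set"
  assumes J: "poset_ideal (Hom_chain P n) J"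
    and inversion: "\<And>i p j q. (i, p) \<in> {1..n} \<times> P \<Longrightarrow> (j, q) \<in> {1..n} \<times> P \<Longrightarrow>
      \<phi> (i, p) = \<phi> (j, q) \<Longrightarrow> (i, p) \<noteq> (j, q) \<Longrightarrow> i < j \<and> q < p \<or> j < i \<and> p < q"
    and S: "S \<in> transversals ({1..n} \<times> P) (graph P ` J)"
  obtains T where "T \<subseteq> S" "T \<in> transversals ({1..n} \<times> P) (graph P ` J)" "inj_on \<phi> T"
proof -
  let ?A = "{1..n} \<times> P" and ?\<G> = "graph P ` J"
  have "finite S" using S by (simp add: transversals_def)
  then obtain T where T: "T \<subseteq> S" "T \<in> transversals ?A ?\<G>"
      "\<And>t. t \<in> T \<Longrightarrow> T - {t} \<notin> transversals ?A ?\<G>"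
    using finite_minimal_subset[of S "\<lambda>T. T \<in> transversals ?A ?\<G>"] S by blast
  have meets: "T \<inter> graph P \<psi> \<noteq> {}" if "\<psi> \<in> J" for \<psi>
    using T(2) that by (auto simp: transversals_def)
  have min: "\<exists>\<psi>\<in>J. (T - {t}) \<inter> graph P \<psi> = {}" if "t \<in> T" for t
    using T(2) T(3)[OF that] by (auto simp: transversals_def)
  have TA: "T \<subseteq> ?A" using T(2) by (simp add: transversals_def)
  have no_inv: False if "(i, p) \<in> T" "(j, q) \<in> T" "i < j" "q < p" for i j p q
    using minimal_transversal_no_inversion[OF J meets min that] .
  have "inj_on \<phi> T"
  proof (rule inj_onI, rule ccontr)
    fix a b assume ab: "a \<in> T" "b \<in> T" "\<phi> a = \<phi> b" "a \<noteq> b"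
    obtain i p j q where "a = (i, p)" "b = (j, q)" by (cases a, cases b) blast
    then show False using ab inversion[of i p j q] no_inv TA by blast
  qed
  with T(1,2) show thesis by (rule that)
qed


section \<open>Duality after identification of variables\<close>

theorem theorem7p3:
  fixes n :: nat
    and P :: "'p::order set"
    and J :: "('p \<Rightarrow> nat) set"
    and R :: "'r::order set"
    and \<phi> :: "nat \<times> 'p \<Rightarrow> 'r"
  assumes "n \<ge> 1"
    and "finite P"
    and "poset_ideal (Hom_chain P n) J"
    and "\<phi> \<in> {1..n} \<times> P \<rightarrow> R"
    and "mono_on ({1..n} \<times> P) \<phi>"
    and "\<And>r. r \<in> R \<Longrightarrow> bistrict_chain (fiber_op n P \<phi> r)"
  shows "are_alexander_dual R
    (letterplace_map R \<phi> n P J :: ('r, 'k::field) mpoly set)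
    (co_letterplace_map R (transpose_map \<phi>) P n J)"
proof -
  let ?A = "{1..n} \<times> P" and ?\<G> = "graph P ` J" and ?B = "P \<times> {1..n}"
  let ?\<H> = "(\<lambda>\<psi>. (\<lambda>p. (p, \<psi> p)) ` P) ` J"
  have JH: "\<psi> \<in> P \<rightarrow>\<^sub>E {1..n} \<and> mono_on P \<psi>" if "\<psi> \<in> J" for \<psi>
    using that assms(3) by (auto simp: poset_ideal_def Hom_chain_def)
  have "finite J"
    using JH assms(2) by (intro finite_subset[OF _ finite_PiE[of P "\<lambda>_. {1..n}"]]) auto
  have graph: "finite G \<and> G \<subseteq> ?A" if "G \<in> ?\<G>" for G
    using that JH assms(2) by (fastforce simp: graph_def PiE_iff)
  have graph': "finite H \<and> H \<subseteq> ?B" if "H \<in> ?\<H>" for H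
    using that JH assms(2) by (fastforce simp: PiE_iff)
  have inversion: "i < j \<and> q < p \<or> j < i \<and> p < q"
    if "(i, p) \<in> ?A" "(j, q) \<in> ?A" "\<phi> (i, p) = \<phi> (j, q)" "(i, p) \<noteq> (j, q)" for i j p q
  proof -
    have "\<phi> (j, q) \<in> R" using that(2) assms(4) by blast
    from bistrict_fiber_inversion[OF assms(6)[OF this]] that show ?thesis by simp
  qed
  have inj_graph: "inj_on \<phi> G" if "G \<in> ?\<G>" for G
  proof (rule inj_onI)
    fix a b assume ab: "a \<in> G" "b \<in> G" "\<phi> a = \<phi> b"
    from that obtain \<psi> where \<psi>: "\<psi> \<in> J" "G = graph P \<psi>" by blast
    then obtain p q where pq: "p \<in> P" "q \<in> P" "a = (\<psi> p, p)" "b = (\<psi> q, q)"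
      using ab by (auto simp: graph_def)
    show "a = b"
    proof (rule ccontr)
      assume "a \<noteq> b"
      then have "\<psi> p < \<psi> q \<and> q < p \<or> \<psi> q < \<psi> p \<and> p < q"
        using ab graph[OF that] unfolding pq by (intro inversion) blast+
      moreover have "mono_on P \<psi>" using JH \<psi>(1) by blast
      then have "\<psi> q \<le> \<psi> p" if "q < p" using that pq by (auto dest: mono_onD)
      moreover have "\<psi> p \<le> \<psi> q" if "p < q"
        using that pq \<open>mono_on P \<psi>\<close> by (auto dest: mono_onD)
      ultimately show False by auto
    qed
  qed
  have co: "co_letterplace P n J = (supp_ideal ?B ?\<H> :: ('p \<times> nat, 'k) mpoly set)"
  proof -
    have "(\<Prod>p\<in>P. Var (p, \<psi> p)) = (sqfree ((\<lambda>p. (p, \<psi> p)) ` P) :: ('p \<times> nat, 'k) mpoly)" for \<psi>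
      by (simp add: sqfree_def prod.reindex inj_on_def)
    then have "{\<Prod>p\<in>P. Var (p, \<psi> p) | \<psi>. \<psi> \<in> J} = (sqfree ` ?\<H> :: ('p \<times> nat, 'k) mpoly set)"
      by auto
    then show ?thesis
      unfolding co_letterplace_def
      using graph' by (simp only:) (intro genideal_eq_supp_ideal, auto intro!: sqfree_in_supp_ideal)
  qed
  have tr: "transpose_map \<phi> ` ((\<lambda>p. (p, \<psi> p)) ` P) = \<phi> ` graph P \<psi>" for \<psi>
    by (auto simp: transpose_map_def graph_def image_image)
  have co_map: "co_letterplace_map R (transpose_map \<phi>) P n J =
      (supp_ideal R ((`) \<phi> ` ?\<G>) :: ('r, 'k) mpoly set)"
  proof -
    have "inj_on (transpose_map \<phi>) H" if "H \<in> ?\<H>" for H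
    proof -
      from that obtain \<psi> where \<psi>: "\<psi> \<in> J" "H = (\<lambda>p. (p, \<psi> p)) ` P" by blast
      then have "inj_on \<phi> (graph P \<psi>)" using inj_graph by blast
      then show ?thesis using \<psi> by (auto simp: inj_on_def graph_def transpose_map_def)
    qed
    moreover have "transpose_map \<phi> ` ?B \<subseteq> R" using assms(4) by (auto simp: transpose_map_def)
    ultimately have "co_letterplace_map R (transpose_map \<phi>) P n J =
        (supp_ideal R ((`) (transpose_map \<phi>) ` ?\<H>) :: ('r, 'k) mpoly set)"
      unfolding co_letterplace_map_def co using graph'
      by (intro genideal_var_map_supp_ideal)
    also have "(`) (transpose_map \<phi>) ` ?\<H> = (`) \<phi> ` ?\<G>"
      unfolding image_image[of "(`) _"] using tr by simp
    finally show ?thesis .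
  qed
  have sw: "(`) prod.swap ` ?\<H> = ?\<G>"
    by (simp add: image_image graph_def)
  have "letterplace n P J = (supp_ideal ?A (transversals ?A ?\<G>) :: (nat \<times> 'p, 'k) mpoly set)"
    unfolding letterplace_def co
  proof (rule alexander_dual_eq_supp_ideal)
    have "sqfree ` ?\<H> \<subseteq> (supp_ideal ?B ?\<H> :: ('p \<times> nat, 'k) mpoly set)"
      using graph' by (auto intro!: sqfree_in_supp_ideal)
    then show "sqfree ` ?\<G> \<subseteq> var_map prod.swap ` (supp_ideal ?B ?\<H> :: ('p \<times> nat, 'k) mpoly set)"
      "var_map prod.swap ` (supp_ideal ?B ?\<H> :: ('p \<times> nat, 'k) mpoly set) \<subseteq> supp_ideal ?A ?\<G>"
      unfolding sw[symmetric] using graph'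
      by (intro var_map_image_sandwich[where A = ?B]; force)+
  qed (use graph in auto)
  define \<M> where "\<M> = {T \<in> transversals ?A ?\<G>. inj_on \<phi> T}"
  have minimal: "\<exists>T\<in>\<M>. T \<subseteq> S" if S: "S \<in> transversals ?A ?\<G>" for S
    using transversal_contains_injective[OF assms(3) inversion S] unfolding \<M>_def by blast
  have "letterplace n P J = (supp_ideal ?A \<M> :: (nat \<times> 'p, 'k) mpoly set)"
    unfolding \<open>letterplace n P J = _\<close>
    by (rule supp_ideal_eqI) (use minimal in \<open>auto simp: \<M>_def\<close>)
  then have "letterplace_map R \<phi> n P J = (supp_ideal R ((`) \<phi> ` \<M>) :: ('r, 'k) mpoly set)"
    unfolding letterplace_map_def using assms(4)
    by (simp only:, intro genideal_var_map_supp_ideal) (auto simp: \<M>_def transversals_def)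
  also have "\<dots> = supp_ideal R (transversals R ((`) \<phi> ` ?\<G>))"
  proof (rule supp_ideal_eqI)
    fix F assume "F \<in> (`) \<phi> ` \<M>"
    then have "F \<in> transversals R ((`) \<phi> ` ?\<G>)"
      using assms(4) by (fastforce simp: \<M>_def transversals_def)
    then show "\<exists>G\<in>transversals R ((`) \<phi> ` ?\<G>). G \<subseteq> F" by blast
  next
    fix W assume W: "W \<in> transversals R ((`) \<phi> ` ?\<G>)"
    have "{a \<in> ?A. \<phi> a \<in> W} \<inter> G \<noteq> {}" if "G \<in> ?\<G>" for G
      using W that graph[OF that] unfolding transversals_def by fastforce
    then have "{a \<in> ?A. \<phi> a \<in> W} \<in> transversals ?A ?\<G>"
      using assms(2) by (auto simp: transversals_def)
    from minimal[OF this] show "\<exists>F\<in>(`) \<phi> ` \<M>. F \<subseteq> W" by blast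
  qed
  finally have lp: "letterplace_map R \<phi> n P J =
    (supp_ideal R (transversals R ((`) \<phi> ` ?\<G>)) :: ('r, 'k) mpoly set)" .
  show ?thesis
    unfolding lp co_map
  proof (rule are_alexander_dual_transversals)
    show "finite ((`) \<phi> ` ?\<G>)" using \<open>finite J\<close> by simp
    show "finite F \<and> F \<subseteq> R" if "F \<in> (`) \<phi> ` ?\<G>" for F
      using that graph assms(4) by fastforce
  qed
qed

end
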